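(* Consider a tenable balanced affine two-colour urn with multiple drawings (under model $\mathcal M$ or model $\mathcal R$), with $T_0+m(a_{m-1}-a_m)>0$, and let $g_n=\prod_{j=0}^{n-1}\frac{T_j}{T_j+m(a_{m-1}-a_m)}$. If $a_m\ne0$, the centered random variable $$\mathcal W_n=g_n(W_n-\mathbb E[W_n])=g_nW_n-a_m\sum_{j=1}^n g_j-W_0$$ is a martingale with respect to the natural filtration: $\mathbb E[\mathcal W_n\mid\mathbb F_{n-1}]=\mathcal W_{n-1}$ for $n\ge1$, and $\mathcal W_0=0$. If $a_m=0$, the random variable $\mathfrak W_n=g_nW_n$ is a non-negative martingale and converges almost surely to a limit $\mathfrak W_\infty$.
   Context: Urn setting. Let $m\ge1$ be an integer (sample size), and let $a_k,b_k$ ($0\le k\le m$) be integers with $a_k+b_k=\sigma$ for all $k$ (the urn is balanced), where $\sigma\ge1$. The urn starts with $W_0,B_0\in\mathbb N_0$ white and black balls, $T_0=W_0+B_0\ge m$. At step $n\ge1$ a sample of $m$ balls is drawn from the urn, which contains $W_{n-1}$ white and $B_{n-1}$ black balls; the sample is returned, and if it contained $k$ white and $m-k$ black balls, then $a_{m-k}$ white and $b_{m-k}$ black balls are added (negative numbers mean removal). Thus $T_n=W_n+B_n=T_0+\sigma n$. $\mathbb F_n$ is the $\sigma$-field generated by the first $n$ draws. Sampling models. Given $\mathbb F_{n-1}$, the probability that the $n$-th sample contains exactly $k$ white balls ($0\le k\le m$) is $\binom{W_{n-1}}{k}\binom{T_{n-1}-W_{n-1}}{m-k}\big/\binom{T_{n-1}}{m}$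 in model $\mathcal M$ (without replacement) and $\binom mk W_{n-1}^k(T_{n-1}-W_{n-1})^{m-k}/T_{n-1}^m$ in model $\mathcal R$ (with replacement). Tenability: in model $\mathcal M$, $a_k\ge-(m-k)$ and $b_k\ge -k$ for $0\le k\le m$; in model $\mathcal R$, $a_k\ge-1$ for $0\le k\le m-1$, $a_m\ge0$, $b_k\ge-1$ for $1\le k\le m$, $b_0\ge0$. Affine urn: $a_k=(m-k)a_{m-1}-(m-k-1)a_m$ for $0\le k\le m$. *)

theory Defs
  imports "HOL-Probability.Probability"
begin

section \<open>Discrete-time martingales\<close>

definition discrete_martingale ::
    "'a measure \<Rightarrow> (nat \<Rightarrow> 'a measure) \<Rightarrow> (nat \<Rightarrow> 'a \<Rightarrow> real) \<Rightarrow> bool" where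
  "discrete_martingale M F X \<longleftrightarrow>
     filtration (space M) F \<and>
     (\<forall>n. subalgebra M (F n)) \<and>
     (\<forall>n. X n \<in> borel_measurable (F n)) \<and>
     (\<forall>n. integrable M (X n)) \<and>
     (\<forall>n\<ge>1. AE \<omega> in M. real_cond_exp M (F (n - 1)) (X n) \<omega> = X (n - 1) \<omega>)"

section \<open>Urn rules and sampling models\<close>

datatype sampling_model = Without_Replacement | With_Replacement

text \<open>
  Probability that a sample of \<open>m\<close> balls from an urn with \<open>w\<close> white and \<open>v\<close> black balls contains
  exactly \<open>k\<close> white balls. The urn contents are integers since the rules \<open>a\<close>, \<open>b\<close> below may
  be negative; tenability guarantees that they stay non-negative almost surely.
\<close>
fun sample_prob :: "sampling_model \<Rightarrow> nat \<Rightarrow> int \<Rightarrow> int \<Rightarrow> nat \<Rightarrow> real" where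
  "sample_prob Without_Replacement m w v k =
     real (nat w choose k) * real (nat v choose (m - k)) / real (nat (w + v) choose m)"
| "sample_prob With_Replacement m w v k =
     real (m choose k) * real_of_int w ^ k * real_of_int v ^ (m - k) / real_of_int (w + v) ^ m"

fun tenable_urn :: "sampling_model \<Rightarrow> nat \<Rightarrow> (nat \<Rightarrow> int) \<Rightarrow> (nat \<Rightarrow> int) \<Rightarrow> bool" where
  "tenable_urn Without_Replacement m a b \<longleftrightarrow>
     (\<forall>k\<le>m. a k \<ge> - int (m - k) \<and> b k \<ge> - int k)"
| "tenable_urn With_Replacement m a b \<longleftrightarrow>
     (\<forall>k<m. a k \<ge> -1) \<and> a m \<ge> 0 \<and> (\<forall>k\<in>{1..m}. b k \<ge> -1) \<and> b 0 \<ge> 0"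

definition affine_urn :: "nat \<Rightarrow> (nat \<Rightarrow> int) \<Rightarrow> bool" where
  "affine_urn m a \<longleftrightarrow>
     (\<forall>k\<le>m. a k = (int m - int k) * a (m - 1) - (int m - int k - 1) * a m)"

section \<open>The urn process\<close>

text \<open>
  \<open>K n\<close>, for \<open>n \<ge> 1\<close>, is the number of white balls in the \<open>n\<close>-th sample; \<open>K 0\<close> plays no role.
\<close>
definition draw_filtration :: "'a measure \<Rightarrow> (nat \<Rightarrow> 'a \<Rightarrow> nat) \<Rightarrow> nat \<Rightarrow> 'a measure" where
  "draw_filtration M K n =
     sigma (space M) {K i -` A \<inter> space M | i A. 1 \<le> i \<and> i \<le> n}"

locale balanced_urn = prob_space M
  for M :: "'a measure" +
  fixes model :: sampling_model
    and m :: nat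
    and a b :: "nat \<Rightarrow> int"
    and \<sigma> :: int
    and W0 B0 :: nat
    and K :: "nat \<Rightarrow> 'a \<Rightarrow> nat"
    and W B :: "nat \<Rightarrow> 'a \<Rightarrow> int"
  assumes sample_size: "m \<ge> 1"
    and balance_pos: "\<sigma> \<ge> 1"
    and balanced: "\<And>k. k \<le> m \<Longrightarrow> a k + b k = \<sigma>"
    and initial_size: "W0 + B0 \<ge> m"
    and K_measurable: "\<And>n. n \<ge> 1 \<Longrightarrow> K n \<in> measurable M (count_space UNIV)"
    and K_le: "\<And>n \<omega>. n \<ge> 1 \<Longrightarrow> \<omega> \<in> space M \<Longrightarrow> K n \<omega> \<le> m"
    and W_0: "\<And>\<omega>. \<omega> \<in> space M \<Longrightarrow> W 0 \<omega> = int W0"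
    and B_0: "\<And>\<omega>. \<omega> \<in> space M \<Longrightarrow> B 0 \<omega> = int B0"
    and W_step: "\<And>n \<omega>. n \<ge> 1 \<Longrightarrow> \<omega> \<in> space M \<Longrightarrow> W n \<omega> = W (n - 1) \<omega> + a (m - K n \<omega>)"
    and B_step: "\<And>n \<omega>. n \<ge> 1 \<Longrightarrow> \<omega> \<in> space M \<Longrightarrow> B n \<omega> = B (n - 1) \<omega> + b (m - K n \<omega>)"
    and sampling: "\<And>n k. n \<ge> 1 \<Longrightarrow> k \<le> m \<Longrightarrow>
      AE \<omega> in M. real_cond_exp M (draw_filtration M K (n - 1))
                    (indicator {\<omega> \<in> space M. K n \<omega> = k}) \<omega>
                  = sample_prob model m (W (n - 1) \<omega>) (B (n - 1) \<omega>) k"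

definition total_balls :: "nat \<Rightarrow> nat \<Rightarrow> int \<Rightarrow> nat \<Rightarrow> int" where
  "total_balls W0 B0 \<sigma> n = int W0 + int B0 + \<sigma> * int n"

lemma (in balanced_urn) total_balls_eq:
  assumes "\<omega> \<in> space M"
  shows "W n \<omega> + B n \<omega> = total_balls W0 B0 \<sigma> n"
proof (induction n)
  case 0
  then show ?case using W_0 B_0 assms by (simp add: total_balls_def)
next
  case (Suc n)
  have "a (m - K (Suc n) \<omega>) + b (m - K (Suc n) \<omega>) = \<sigma>"
    by (rule balanced) simp
  then show ?case
    using Suc W_step[of "Suc n" \<omega>] B_step[of "Suc n" \<omega>] assms
    by (simp add: total_balls_def algebra_simps)
qed

definition urn_scale :: "nat \<Rightarrow> (nat \<Rightarrow> int) \<Rightarrow> (nat \<Rightarrow> int) \<Rightarrow> nat \<Rightarrow> real" where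
  "urn_scale m a T n =
     (\<Prod>j<n. real_of_int (T j) / real_of_int (T j + int m * (a (m - 1) - a m)))"

end

(*
  Affinity makes the increment of W linear in the number of white balls in the sample, which under
  both sampling models has conditional mean m W / T. Hence the conditional expectation of the next
  W is (T + m (a_{m-1} - a_m)) / T * W + a_m, and the factor is cancelled by g. Tenability is needed
  because the sample mean formula requires non-negative urn contents: a configuration that would
  make W or B negative is sampled with probability zero. Almost sure convergence for a_m = 0 is
  Doob's theorem for non-negative martingales, proved by counting upcrossings.
*)

theory Submission
  imports Defs
begin

section \<open>Almost sure convergence of non-negative martingales\<close>

text \<open>
  Doob's betting strategy on a sequence \<open>x\<close>: \<open>holding\<close> says that a unit stake is held from time
  \<open>n\<close> to \<open>n + 1\<close>, the stake being bought below \<open>a\<close> and sold above \<open>b\<close>.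
\<close>
primrec holding :: "real \<Rightarrow> real \<Rightarrow> (nat \<Rightarrow> real) \<Rightarrow> nat \<Rightarrow> bool" where
  "holding a b x 0 \<longleftrightarrow> x 0 < a"
| "holding a b x (Suc n) \<longleftrightarrow> (if holding a b x n then x (Suc n) \<le> b else x (Suc n) < a)"

text \<open>A crossing is counted at the moment of the sale, so a stake still open at time
  \<open>n\<close> is not included.\<close>

primrec upcrossings :: "real \<Rightarrow> real \<Rightarrow> (nat \<Rightarrow> real) \<Rightarrow> nat \<Rightarrow> nat" where
  "upcrossings a b x 0 = 0"
| "upcrossings a b x (Suc n) =
     upcrossings a b x n + (if holding a b x n \<and> b < x (Suc n) then 1 else 0)"

section \<open>Pathwise analysis of crossings\<close>

lemma upcrossings_le: "upcrossings a b x n \<le> n"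
  by (induction n) auto

text \<open>Reading \<open>X\<close> only up to time \<open>n\<close> makes the stake held from
  \<open>n\<close> to \<open>n + 1\<close> known at time \<open>n\<close>, so that it can serve as
  the factor \<open>C\<close> in \<open>discrete_martingale_step\<close>.\<close>

lemma holding_measurable:
  assumes "\<And>i. i \<le> n \<Longrightarrow> X i \<in> borel_measurable N"
  shows "Measurable.pred N (\<lambda>\<omega>. holding a b (\<lambda>i. X i \<omega>) n)"
  using assms
proof (induction n)
  case 0
  have [measurable]: "X 0 \<in> borel_measurable N" by (rule 0) simp
  show ?case by simp
next
  case (Suc n)
  have [measurable]: "X (Suc n) \<in> borel_measurable N"
    "Measurable.pred N (\<lambda>\<omega>. holding a b (\<lambda>i. X i \<omega>) n)"
    using Suc by auto
  show ?case by simp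
qed

lemma upcrossings_measurable:
  assumes "\<And>i. X i \<in> borel_measurable N"
  shows "(\<lambda>\<omega>. upcrossings a b (\<lambda>i. X i \<omega>) n) \<in> measurable N (count_space UNIV)"
proof (induction n)
  case (Suc n)
  have [measurable]: "X (Suc n) \<in> borel_measurable N"
    "Measurable.pred N (\<lambda>\<omega>. holding a b (\<lambda>i. X i \<omega>) n)"
    using assms by (auto intro: holding_measurable)
  note [measurable] = Suc
  show ?case by simp
qed simp

text \<open>Each sale completes a round trip worth at least \<open>b - a\<close>. The second summand
  is the unrealised gain on an open stake, counted as if it had been bought at \<open>a\<close>; it
  carries the induction, because a purchase below \<open>a\<close> only makes it negative.\<close>

lemma upcrossings_gain:
  assumes "a < b"
  shows "(b - a) * real (upcrossings a b x n) + (if holding a b x n then x n - a else 0)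
           \<le> (\<Sum>i<n. of_bool (holding a b x i) * (x (Suc i) - x i))"
proof (induction n)
  case (Suc n)
  then show ?case using assms by (auto simp: algebra_simps split: if_splits)
qed simp

text \<open>If the count stopped at \<open>k\<close>, a stake held after a later dip below
  \<open>a\<close> could never be sold, yet the next value above \<open>b\<close> forces a
  sale.\<close>

lemma unbounded_upcrossings:
  assumes "a < b" "\<exists>\<^sub>F n in sequentially. x n < a" "\<exists>\<^sub>F n in sequentially. b < x n"
  shows "\<exists>n. k \<le> upcrossings a b x n"
proof (induction k)
  case (Suc k)
  then obtain n where n: "k \<le> upcrossings a b x n" by blast
  have mono: "upcrossings a b x n \<le> upcrossings a b x j" if "n \<le> j" for j
    using that by (induction rule: dec_induct) auto
  show ?case
  proof (rule ccontr)
    assume "\<nexists>n. Suc k \<le> upcrossings a b x n"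
    then have const: "upcrossings a b x j = k" if "n \<le> j" for j
      using mono[OF that] n by (metis le_antisym le_trans not_less_eq_eq)
    obtain i where i: "n \<le> i" "x i < a"
      using assms(2) by (auto simp: frequently_sequentially)
    \<comment> \<open>After the dip a stake is held, whether bought then or earlier; selling it
      would raise the count, which is constant from \<open>n\<close> on.\<close>
    have hold: "holding a b x j" if "i \<le> j" for j
      using that
    proof (induction rule: dec_induct)
      case base
      then show ?case using i(2) assms(1) by (cases i) auto
    next
      case (step j)
      then show ?case using const[of j] const[of "Suc j"] i(1) by (auto split: if_splits)
    qed
    obtain j where j: "Suc i \<le> j" "b < x j"
      using assms(3) by (auto simp: frequently_sequentially)
    then show False using hold[of "j - 1"] hold[of j] by (cases j) auto
  qed
qed simp

text \<open>If the limsup exceeded the liminf, two rationals in the gap would be crossed infinitely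
  often. Rational levels leave only countably many pairs to exclude, and a finite liminf excludes
  divergence to infinity.\<close>

lemma convergent_of_no_crossings:
  fixes x :: "nat \<Rightarrow> real"
  assumes nonneg: "\<And>n. 0 \<le> x n"
    and fin: "liminf (\<lambda>n. ennreal (x n)) \<noteq> \<infinity>"
    and no_crossing: "\<And>a b. \<lbrakk>a \<in> \<rat>; b \<in> \<rat>; 0 \<le> a; a < b; \<exists>\<^sub>F n in sequentially. x n < a;
                        \<exists>\<^sub>F n in sequentially. b < x n\<rbrakk> \<Longrightarrow> False"
  shows "convergent x"
proof -
  obtain l where l: "0 \<le> l" "liminf (\<lambda>n. ennreal (x n)) = ennreal l"
    using fin by (cases "liminf (\<lambda>n. ennreal (x n))" rule: ennreal_cases) auto
  have "limsup (\<lambda>n. ennreal (x n)) \<le> ennreal l"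
  proof (rule ccontr)
    assume "\<not> ?thesis"
    then have *: "ennreal l < limsup (\<lambda>n. ennreal (x n))" by simp
    \<comment> \<open>A real number \<open>u\<close> marks the upper end of the gap because the
      limsup may be infinite; \<open>l + 1\<close> serves in that case.\<close>
    obtain u where u: "l < u" "ennreal u \<le> limsup (\<lambda>n. ennreal (x n))"
    proof (cases "limsup (\<lambda>n. ennreal (x n))" rule: ennreal_cases)
      case (real r)
      then show ?thesis using that[of r] * l(1) by (simp add: ennreal_less_iff)
    next
      case top
      then show ?thesis using that[of "l + 1"] by simp
    qed
    obtain b where b: "b \<in> \<rat>" "l < b" "b < u" using Rats_dense_in_real[OF u(1)] by auto
    obtain a where a: "a \<in> \<rat>" "l < a" "a < b" using Rats_dense_in_real[OF b(2)] by auto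
    have "\<exists>\<^sub>F n in sequentially. x n < a"
    proof (rule ccontr)
      assume "\<not> ?thesis"
      then have "\<forall>\<^sub>F n in sequentially. ennreal a \<le> ennreal (x n)"
        by (auto simp: not_frequently not_less intro: ennreal_leI elim: eventually_mono)
      then have "ennreal a \<le> ennreal l" using Liminf_bounded l(2) by metis
      then show False using a(2) l(1) by (simp add: ennreal_le_iff)
    qed
    moreover have "\<exists>\<^sub>F n in sequentially. b < x n"
    proof (rule ccontr)
      assume "\<not> ?thesis"
      then have "\<forall>\<^sub>F n in sequentially. ennreal (x n) \<le> ennreal b"
        by (auto simp: not_frequently not_less intro: ennreal_leI elim: eventually_mono)
      then have "ennreal u \<le> ennreal b" using Limsup_bounded u(2) by (metis order_trans)
      then show False using b l(1) by (simp add: ennreal_le_iff)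
    qed
    ultimately show False using no_crossing[OF a(1) b(1)] a l(1) by simp
  qed
  moreover have "ennreal l \<le> limsup (\<lambda>n. ennreal (x n))"
    using Liminf_le_Limsup[of sequentially "\<lambda>n. ennreal (x n)"] l(2) by simp
  ultimately have "(\<lambda>n. ennreal (x n)) \<longlonglongrightarrow> ennreal l"
    by (intro Liminf_eq_Limsup) (auto simp: l(2))
  \<comment> \<open>The return to real limits rests on non-negativity, as \<open>ennreal\<close>
    sends negative numbers to 0.\<close>
  then have "x \<longlonglongrightarrow> l"
    by (rule tendsto_ennrealD) (use l nonneg in auto)
  then show ?thesis by (rule convergentI)
qed

section \<open>Fair games and Doob's upcrossing estimate\<close>

context prob_space
begin

text \<open>A factor known at time \<open>n\<close> passes inside the conditional expectation. With
  \<open>C = 1\<close> this gives constancy of the mean; with a stake as \<open>C\<close> it says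
  that one round of betting is fair.\<close>

lemma discrete_martingale_step:
  assumes "discrete_martingale M F X" "C \<in> borel_measurable (F n)"
    "integrable M (\<lambda>\<omega>. C \<omega> * X (Suc n) \<omega>)"
  shows "(\<integral>\<omega>. C \<omega> * X (Suc n) \<omega> \<partial>M) = (\<integral>\<omega>. C \<omega> * X n \<omega> \<partial>M)"
proof -
  have sub: "subalgebra M (F n)" and intX: "\<And>n. integrable M (X n)"
    and ce: "AE \<omega> in M. real_cond_exp M (F n) (X (Suc n)) \<omega> = X n \<omega>"
    using assms(1) unfolding discrete_martingale_def by (force dest: spec[of _ "Suc n"])+
  interpret finite_measure_subalgebra M "F n" by standard (rule sub)
  have [measurable]: "C \<in> borel_measurable M" "X n \<in> borel_measurable M"
    using measurable_from_subalg[OF sub assms(2)] intX by auto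
  have "(\<integral>\<omega>. C \<omega> * X (Suc n) \<omega> \<partial>M)
          = (\<integral>\<omega>. C \<omega> * real_cond_exp M (F n) (X (Suc n)) \<omega> \<partial>M)"
    using assms intX by (intro real_cond_exp_intg(2)[symmetric]) auto
  also have "\<dots> = (\<integral>\<omega>. C \<omega> * X n \<omega> \<partial>M)"
    using ce by (intro integral_cong_AE) auto
  finally show ?thesis .
qed

lemma discrete_martingale_expectation:
  assumes "discrete_martingale M F X"
  shows "expectation (X n) = expectation (X 0)"
proof (induction n)
  case (Suc n)
  then show ?case
    using discrete_martingale_step[OF assms, of "\<lambda>_. 1" n] assms
    by (simp add: discrete_martingale_def)
qed simp

lemma discrete_martingale_measurable:
  assumes "discrete_martingale M F X" "i \<le> n"
  shows "X i \<in> borel_measurable (F n)"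
proof -
  have "subalgebra (F n) (F i)"
    using assms filtration.space_F filtration.sets_F_mono
    unfolding discrete_martingale_def subalgebra_def by metis
  then show ?thesis
    using assms(1) measurable_from_subalg unfolding discrete_martingale_def by blast
qed

text \<open>
  The gain of the strategy has expectation zero, and non-negativity of \<open>X\<close> bounds the loss on a
  stake still held at time \<open>n\<close> by \<open>a\<close>.
\<close>
lemma expectation_upcrossings_le:
  assumes X: "discrete_martingale M F X" and nonneg: "AE \<omega> in M. 0 \<le> X n \<omega>"
    and ab: "0 \<le> a" "a < b"
  shows "(b - a) * expectation (\<lambda>\<omega>. real (upcrossings a b (\<lambda>i. X i \<omega>) n)) \<le> a"
proof -
  let ?H = "\<lambda>i \<omega>. of_bool (holding a b (\<lambda>i. X i \<omega>) i) :: real"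
  have intX: "integrable M (X i)" for i using X by (simp add: discrete_martingale_def)
  have HF: "?H i \<in> borel_measurable (F i)" for i
  proof -
    have [measurable]: "Measurable.pred (F i) (\<lambda>\<omega>. holding a b (\<lambda>i. X i \<omega>) i)"
      by (rule holding_measurable) (rule discrete_martingale_measurable[OF X])
    show ?thesis by measurable
  qed
  have [measurable]: "?H i \<in> borel_measurable M" for i
    using X HF[of i] by (auto simp: discrete_martingale_def intro: measurable_from_subalg)
  have intH: "integrable M (\<lambda>\<omega>. ?H i \<omega> * X j \<omega>)" for i j
    by (rule Bochner_Integration.integrable_bound[OF intX[of j]]) (use intX in auto)
  have intU: "integrable M (\<lambda>\<omega>. real (upcrossings a b (\<lambda>i. X i \<omega>) n))"
  proof (rule integrable_const_bound[where B = "real n"])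
    have [measurable]: "(\<lambda>\<omega>. upcrossings a b (\<lambda>i. X i \<omega>) n) \<in> measurable M (count_space UNIV)"
      by (rule upcrossings_measurable) (use intX in auto)
    show "(\<lambda>\<omega>. real (upcrossings a b (\<lambda>i. X i \<omega>) n)) \<in> borel_measurable M" by measurable
  qed (simp add: upcrossings_le)
  have "(b - a) * expectation (\<lambda>\<omega>. real (upcrossings a b (\<lambda>i. X i \<omega>) n)) - a
          = expectation (\<lambda>\<omega>. (b - a) * real (upcrossings a b (\<lambda>i. X i \<omega>) n) - a)"
    using intU by (simp add: prob_space)
  \<comment> \<open>The gain is written with differences of products so that the fairness of each
    round applies term by term.\<close>
  also have "\<dots> \<le> expectation (\<lambda>\<omega>. \<Sum>i<n. ?H i \<omega> * X (Suc i) \<omega> - ?H i \<omega> * X i \<omega>)"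
  proof (rule integral_mono_AE)
    show "AE \<omega> in M. (b - a) * real (upcrossings a b (\<lambda>i. X i \<omega>) n) - a
            \<le> (\<Sum>i<n. ?H i \<omega> * X (Suc i) \<omega> - ?H i \<omega> * X i \<omega>)"
      using nonneg
    proof eventually_elim
      case (elim \<omega>)
      then show ?case
        using upcrossings_gain[OF ab(2), of "\<lambda>i. X i \<omega>" n] ab(1)
        by (auto simp: right_diff_distrib split: if_splits)
    qed
  qed (use intU intH in auto)
  also have "\<dots> = 0"
    using intH discrete_martingale_step[OF X HF intH] by simp
  finally show ?thesis by simp
qed

text \<open>The bound \<open>a / (b - a)\<close> on the expected number of crossings does not depend
  on \<open>n\<close>. Monotone convergence carries it over to the total number of crossings, which
  is therefore almost surely finite.\<close>

lemma AE_no_crossing: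
  assumes X: "discrete_martingale M F X" and nonneg: "\<And>n. AE \<omega> in M. 0 \<le> X n \<omega>"
    and ab: "0 \<le> a" "a < b"
  shows "AE \<omega> in M. \<not> ((\<exists>\<^sub>F n in sequentially. X n \<omega> < a) \<and> (\<exists>\<^sub>F n in sequentially. b < X n \<omega>))"
proof -
  let ?U = "\<lambda>n \<omega>. upcrossings a b (\<lambda>i. X i \<omega>) n"
  have [measurable]: "X i \<in> borel_measurable M" for i
    using X by (auto simp: discrete_martingale_def)
  have [measurable]: "?U n \<in> measurable M (count_space UNIV)" for n
    by (rule upcrossings_measurable) simp
  have "(\<integral>\<^sup>+ \<omega>. ennreal (real (?U n \<omega>)) \<partial>M) \<le> ennreal (a / (b - a))" for n
  proof -
    have "integrable M (\<lambda>\<omega>. real (?U n \<omega>))"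
      by (rule integrable_const_bound[where B = "real n"]) (auto simp: upcrossings_le)
    then have "(\<integral>\<^sup>+ \<omega>. ennreal (real (?U n \<omega>)) \<partial>M) = ennreal (expectation (\<lambda>\<omega>. real (?U n \<omega>)))"
      by (intro nn_integral_eq_integral) auto
    moreover have "expectation (\<lambda>\<omega>. real (?U n \<omega>)) \<le> a / (b - a)"
      using expectation_upcrossings_le[OF X nonneg ab] ab(2)
      by (simp add: pos_le_divide_eq mult.commute)
    ultimately show ?thesis by (simp add: ennreal_leI)
  qed
  then have "(SUP n. \<integral>\<^sup>+ \<omega>. ennreal (real (?U n \<omega>)) \<partial>M) \<le> ennreal (a / (b - a))"
    by (rule SUP_least)
  moreover have "(\<integral>\<^sup>+ \<omega>. (SUP n. ennreal (real (?U n \<omega>))) \<partial>M)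
                   = (SUP n. \<integral>\<^sup>+ \<omega>. ennreal (real (?U n \<omega>)) \<partial>M)"
    by (rule nn_integral_monotone_convergence_SUP)
       (auto intro!: incseq_SucI le_funI ennreal_leI)
  ultimately have "(\<integral>\<^sup>+ \<omega>. (SUP n. ennreal (real (?U n \<omega>))) \<partial>M) \<noteq> \<infinity>"
    by (metis ennreal_neq_top infinity_ennreal_def top.extremum_uniqueI)
  then have "AE \<omega> in M. (SUP n. ennreal (real (?U n \<omega>))) \<noteq> \<infinity>"
    by (intro nn_integral_noteq_infinite) auto
  then show ?thesis
  proof eventually_elim
    case (elim \<omega>)
    show ?case
    proof
      assume cross: "(\<exists>\<^sub>F n in sequentially. X n \<omega> < a) \<and> (\<exists>\<^sub>F n in sequentially. b < X n \<omega>)"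
      have "(SUP k. of_nat k :: ennreal) \<le> (SUP n. ennreal (real (?U n \<omega>)))"
      proof (rule SUP_least)
        fix k :: nat
        obtain n where "k \<le> ?U n \<omega>"
          using unbounded_upcrossings[OF ab(2), of "\<lambda>i. X i \<omega>"] cross by blast
        then have "of_nat k \<le> ennreal (real (?U n \<omega>))"
          by (simp add: ennreal_of_nat_eq_real_of_nat ennreal_leI)
        then show "of_nat k \<le> (SUP n. ennreal (real (?U n \<omega>)))"
          by (rule SUP_upper2[rotated]) simp
      qed
      then show False using elim by (simp add: ennreal_SUP_of_nat_eq_top top_unique)
    qed
  qed
qed

text \<open>Fatou's lemma and the constant mean make the liminf almost surely finite; the absence of
  rational crossings then forces convergence.\<close>

theorem nonneg_martingale_convergent:
  assumes X: "discrete_martingale M F X" and nonneg: "\<And>n. AE \<omega> in M. 0 \<le> X n \<omega>"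
  shows "AE \<omega> in M. convergent (\<lambda>n. X n \<omega>)"
proof -
  have intX: "integrable M (X n)" for n using X by (simp add: discrete_martingale_def)
  then have [measurable]: "X n \<in> borel_measurable M" for n by auto
  have "(\<integral>\<^sup>+ \<omega>. liminf (\<lambda>n. ennreal (X n \<omega>)) \<partial>M) \<le> liminf (\<lambda>n. \<integral>\<^sup>+ \<omega>. ennreal (X n \<omega>) \<partial>M)"
    by (rule nn_integral_liminf) simp
  also have "(\<lambda>n. \<integral>\<^sup>+ \<omega>. ennreal (X n \<omega>) \<partial>M) = (\<lambda>_. ennreal (expectation (X 0)))"
    using nn_integral_eq_integral[OF intX nonneg] discrete_martingale_expectation[OF X] by metis
  also have "liminf (\<lambda>_. ennreal (expectation (X 0))) = ennreal (expectation (X 0))"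
    by (simp add: Liminf_const)
  finally have "(\<integral>\<^sup>+ \<omega>. liminf (\<lambda>n. ennreal (X n \<omega>)) \<partial>M) \<noteq> \<infinity>"
    by (metis ennreal_neq_top infinity_ennreal_def top.extremum_uniqueI)
  then have fin: "AE \<omega> in M. liminf (\<lambda>n. ennreal (X n \<omega>)) \<noteq> \<infinity>"
    by (intro nn_integral_noteq_infinite) auto
  \<comment> \<open>The conditions on the levels move inside the almost sure statement, which can
    then be intersected over all pairs of rationals.\<close>
  have "AE \<omega> in M. 0 \<le> a \<longrightarrow> a < b \<longrightarrow>
          \<not> ((\<exists>\<^sub>F n in sequentially. X n \<omega> < a) \<and> (\<exists>\<^sub>F n in sequentially. b < X n \<omega>))" for a b
    using AE_no_crossing[OF X nonneg] by (cases "0 \<le> a \<and> a < b") auto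
  then have cross: "AE \<omega> in M. \<forall>a\<in>\<rat>. \<forall>b\<in>\<rat>. 0 \<le> a \<longrightarrow> a < b \<longrightarrow>
          \<not> ((\<exists>\<^sub>F n in sequentially. X n \<omega> < a) \<and> (\<exists>\<^sub>F n in sequentially. b < X n \<omega>))"
    by (intro AE_ball_countable'[OF _ countable_rat]) auto
  have "AE \<omega> in M. \<forall>n. 0 \<le> X n \<omega>" using nonneg by (simp add: AE_all_countable)
  then show ?thesis using fin cross
  proof eventually_elim
    case (elim \<omega>)
    then show ?case by (intro convergent_of_no_crossings) blast+
  qed
qed

end

section \<open>Sampling models\<close>

text \<open>Absorption, \<open>k * (w choose k) = w * ((w - 1) choose (k - 1))\<close> for positive
  \<open>k\<close>, reduces the sum to Vandermonde's identity; a second absorption treats the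
  denominator.\<close>

lemma hypergeometric_mean:
  fixes w v m :: nat
  assumes "0 < m" "m \<le> w + v"
  shows "(\<Sum>k\<le>m. real k * (real (w choose k) * real (v choose (m - k)) / real ((w + v) choose m)))
           = real m * real w / real (w + v)"
proof -
  obtain r where r: "m = Suc r" using assms(1) by (cases m) auto
  have "(\<Sum>k\<le>m. k * (w choose k) * (v choose (m - k)))
          = (\<Sum>k\<le>r. w * (((w - 1) choose k) * (v choose (r - k))))"
    unfolding r by (subst sum.atMost_Suc_shift) (simp add: binomial_absorption mult.assoc del: mult_Suc)
  \<comment> \<open>For \<open>w = 0\<close> both sides vanish, so the truncated difference
    \<open>w - 1\<close> does no harm.\<close>
  also have "\<dots> = w * ((w + v - 1) choose r)"
    by (cases w) (simp_all add: vandermonde del: mult_Suc flip: sum_distrib_left)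
  finally have sum: "(\<Sum>k\<le>m. k * (w choose k) * (v choose (m - k))) = w * ((w + v - 1) choose r)" .
  have absorb: "m * ((w + v) choose m) = (w + v) * ((w + v - 1) choose r)"
    unfolding r by (rule binomial_absorption)
  have pos: "real ((w + v) choose m) > 0" "real (w + v) > 0" using assms by auto
  have "(\<Sum>k\<le>m. real k * (real (w choose k) * real (v choose (m - k)) / real ((w + v) choose m)))
          = real (\<Sum>k\<le>m. k * (w choose k) * (v choose (m - k))) / real ((w + v) choose m)"
    by (simp add: sum_divide_distrib mult.assoc)
  also have "\<dots> = real (w * ((w + v - 1) choose r)) / real ((w + v) choose m)"
    unfolding sum ..
  also have "\<dots> = real m * real w / real (w + v)"
  proof -
    have "real m * real ((w + v) choose m) = real (w + v) * real ((w + v - 1) choose r)"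
      using absorb by (metis of_nat_mult)
    then have "real w * real ((w + v - 1) choose r) * real (w + v)
                 = real m * real w * real ((w + v) choose m)"
      by (simp add: mult_ac)
    then show ?thesis using pos by (simp add: frac_eq_eq del: of_nat_add)
  qed
  finally show ?thesis .
qed

text \<open>Absorption again, now followed by the binomial theorem. The sum is left unnormalised,
  which avoids dividing by a power of \<open>x + y\<close>.\<close>

lemma binomial_mean:
  fixes x y :: real
  assumes "0 < m"
  shows "(\<Sum>k\<le>m. real k * (real (m choose k) * x ^ k * y ^ (m - k))) = real m * x * (x + y) ^ (m - 1)"
proof -
  obtain r where r: "m = Suc r" using assms by (cases m) auto
  have absorb: "real (Suc k) * (real (Suc r choose Suc k) * x ^ Suc k * y ^ (Suc r - Suc k))
          = real (Suc r) * x * (real (r choose k) * x ^ k * y ^ (r - k))" for k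
  proof -
    have "real (Suc k) * real (Suc r choose Suc k) = real (Suc r) * real (r choose k)"
      using binomial_absorption[of k "Suc r"] by (metis diff_Suc_1 of_nat_mult)
    then have "real (Suc k) * real (Suc r choose Suc k) * (x * x ^ k * y ^ (r - k))
                 = real (Suc r) * real (r choose k) * (x * x ^ k * y ^ (r - k))"
      by (simp only:)
    then show ?thesis unfolding power_Suc diff_Suc_Suc by (simp only: mult_ac)
  qed
  have "(\<Sum>k\<le>m. real k * (real (m choose k) * x ^ k * y ^ (m - k)))
               = (\<Sum>k\<le>r. real (Suc r) * x * (real (r choose k) * x ^ k * y ^ (r - k)))"
    unfolding r by (subst sum.atMost_Suc_shift) (simp only: absorb of_nat_0 mult_zero_left add_0_left)
  also have "\<dots> = real (Suc r) * x * (x + y) ^ r"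
    unfolding binomial_ring sum_distrib_left ..
  finally show ?thesis by (simp only: r diff_Suc_1)
qed

text \<open>Both models share this mean, which lets one argument cover them. Without replacement the
  signs matter because \<open>nat\<close> truncates negative contents.\<close>

lemma sample_prob_mean:
  assumes "0 < m" "0 \<le> w" "0 \<le> v" "int m \<le> w + v"
  shows "(\<Sum>k\<le>m. real k * sample_prob model m w v k)
           = real m * real_of_int w / real_of_int (w + v)"
proof (cases model)
  case Without_Replacement
  then show ?thesis
    using hypergeometric_mean[of m "nat w" "nat v"] assms by (simp add: nat_add_distrib)
next
  case With_Replacement
  obtain r where r: "m = Suc r" using assms(1) by (cases m) auto
  have "(\<Sum>k\<le>m. real k * sample_prob model m w v k)
          = (\<Sum>k\<le>m. real k * (real (m choose k) * real_of_int w ^ k * real_of_int v ^ (m - k)))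
              / real_of_int (w + v) ^ m"
    unfolding With_Replacement by (simp add: sum_divide_distrib)
  also have "\<dots> = real m * real_of_int w / real_of_int (w + v)"
    unfolding binomial_mean[OF assms(1)] using assms(4) by (simp add: r)
  finally show ?thesis .
qed

text \<open>A sample of non-zero probability contains only colours and, without replacement, only
  balls that the urn can supply. Tenability allows the removal of at most the drawn balls of each
  colour, and with replacement of at most one ball of a drawn colour.\<close>

lemma tenable_step_nonneg:
  assumes "tenable_urn model m a b" "k \<le> m" "0 \<le> w" "0 \<le> v" "sample_prob model m w v k \<noteq> 0"
  shows "0 \<le> w + a (m - k)" "0 \<le> v + b (m - k)"
proof -
  have "0 \<le> w + a (m - k) \<and> 0 \<le> v + b (m - k)"
  proof (cases model)
    case Without_Replacement
    then have "k \<le> nat w" "m - k \<le> nat v"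
      using assms(5) by (auto simp: not_le[symmetric] binomial_eq_0_iff)
    \<comment> \<open>The rules are indexed by the number of black balls in the sample, here
      \<open>m - k\<close>.\<close>
    moreover have "- int k \<le> a (m - k)" "- int (m - k) \<le> b (m - k)"
      using assms(1,2) Without_Replacement by (auto dest: spec[of _ "m - k"])
    ultimately show ?thesis using assms(3,4) by linarith
  next
    case With_Replacement
    \<comment> \<open>An empty colour contributes a power of 0, which is non-zero only for exponent
      0.\<close>
    then have "k = 0 \<or> 1 \<le> w" "k = m \<or> 1 \<le> v"
      using assms(2-5) by (auto simp: power_0_left split: if_splits)
    moreover have "- 1 \<le> a (m - k)" if "k \<noteq> 0" using assms(1,2) that With_Replacement by auto
    moreover have "- 1 \<le> b (m - k)" if "k \<noteq> m" using assms(1,2) that With_Replacement by auto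
    moreover have "0 \<le> a m" "0 \<le> b 0" using assms(1) With_Replacement by auto
    ultimately show ?thesis using assms(3,4) by (cases "k = 0"; cases "k = m") force+
  qed
  then show "0 \<le> w + a (m - k)" "0 \<le> v + b (m - k)" by auto
qed

text \<open>Reindexing by the number \<open>k\<close> of white balls drawn exposes the linearity
  that reduces the mean increment to the mean of \<open>k\<close>.\<close>

lemma affine_urn_rule:
  assumes "affine_urn m a" "k \<le> m"
  shows "a (m - k) = a m + int k * (a (m - 1) - a m)"
proof -
  have "a (m - k) = (int m - int (m - k)) * a (m - 1) - (int m - int (m - k) - 1) * a m"
    using assms(1) diff_le_self unfolding affine_urn_def by blast
  then show ?thesis using assms(2) by (simp add: of_nat_diff algebra_simps)
qed

text \<open>The set \<open>Z\<close> where the conditional probability vanishes belongs to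
  \<open>F\<close>, so the measure of \<open>Z \<inter> E\<close> is the integral of that
  probability over \<open>Z\<close>, which is 0.\<close>

lemma (in finite_measure_subalgebra) AE_real_cond_exp_indicator_neq_0:
  assumes [measurable]: "E \<in> sets M"
  shows "AE \<omega> in M. \<omega> \<in> E \<longrightarrow> real_cond_exp M F (indicator E) \<omega> \<noteq> 0"
proof -
  let ?p = "real_cond_exp M F (indicator E)"
  define Z where "Z = {\<omega> \<in> space M. ?p \<omega> = 0}"
  have spF: "space F = space M" using subalg by (simp add: subalgebra_def)
  have [measurable]: "Z \<in> sets F" unfolding Z_def spF[symmetric] by measurable
  have [measurable]: "Z \<in> sets M" using subalg \<open>Z \<in> sets F\<close> by (auto simp: subalgebra_def)
  have "measure M (Z \<inter> E) = (\<integral>\<omega>\<in>Z. indicator E \<omega> \<partial>M)"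
    by (simp add: set_lebesgue_integral_def flip: indicator_inter_arith)
  also have "\<dots> = (\<integral>\<omega>\<in>Z. ?p \<omega> \<partial>M)"
    by (rule real_cond_exp_intA) (auto simp: integrable_indicator_iff less_top[symmetric])
  also have "\<dots> = 0"
    unfolding set_lebesgue_integral_def
    by (rule integral_eq_zero_AE) (auto simp: Z_def indicator_def)
  finally have "Z \<inter> E \<in> null_sets M" by (auto simp: null_sets_def emeasure_eq_measure)
  then show ?thesis
    by (rule AE_I') (auto simp: Z_def)
qed

section \<open>The urn process\<close>

context balanced_urn
begin

abbreviation G :: "nat \<Rightarrow> 'a measure" where "G \<equiv> draw_filtration M K"

lemma space_draw_filtration [simp]: "space (G n) = space M"
  unfolding draw_filtration_def by (rule space_measure_of) auto

lemma sets_draw_filtration: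
  "sets (G n) = sigma_sets (space M) {K i -` A \<inter> space M | i A. 1 \<le> i \<and> i \<le> n}"
  unfolding draw_filtration_def by (rule sets_measure_of) auto

lemma filtration_draw: "filtration (space M) G"
proof
  fix i j :: nat assume "i \<le> j"
  then have "{K l -` A \<inter> space M | l A. 1 \<le> l \<and> l \<le> i} \<subseteq> {K l -` A \<inter> space M | l A. 1 \<le> l \<and> l \<le> j}"
    using le_trans by blast
  then show "sets (G i) \<subseteq> sets (G j)" unfolding sets_draw_filtration by (rule sigma_sets_mono')
qed simp

lemma subalgebra_draw: "subalgebra M (G n)"
  unfolding subalgebra_def sets_draw_filtration
  by (auto intro!: sets.sigma_sets_subset measurable_sets[OF K_measurable])

lemma K_draw_measurable:
  assumes "1 \<le> i" "i \<le> n"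
  shows "K i \<in> measurable (G n) (count_space UNIV)"
  by (rule measurableI) (use assms in \<open>auto simp: sets_draw_filtration\<close>)

text \<open>The bound \<open>i \<le> n\<close> lets the induction on \<open>i\<close> run inside one
  fixed sigma-field.\<close>

lemma W_B_draw_measurable:
  assumes "i \<le> n"
  shows "W i \<in> measurable (G n) (count_space UNIV)" "B i \<in> measurable (G n) (count_space UNIV)"
proof -
  have "W i \<in> measurable (G n) (count_space UNIV) \<and> B i \<in> measurable (G n) (count_space UNIV)"
    using assms
  proof (induction i)
    case 0
    \<comment> \<open>The equations for \<open>W\<close> and \<open>B\<close> hold on
      \<open>space M\<close> only, so measurability is transferred by congruence instead of
      rewriting.\<close>
    have "W 0 \<in> measurable (G n) (count_space UNIV) \<longleftrightarrow> (\<lambda>_. int W0) \<in> measurable (G n) (count_space UNIV)"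
      "B 0 \<in> measurable (G n) (count_space UNIV) \<longleftrightarrow> (\<lambda>_. int B0) \<in> measurable (G n) (count_space UNIV)"
      by (rule measurable_cong, simp add: W_0 B_0)+
    then show ?case by simp
  next
    case (Suc i)
    have [measurable]: "K (Suc i) \<in> measurable (G n) (count_space UNIV)"
      using Suc by (intro K_draw_measurable) auto
    have [measurable]: "W i \<in> measurable (G n) (count_space UNIV)"
      "B i \<in> measurable (G n) (count_space UNIV)" using Suc by auto
    have "(\<lambda>\<omega>. W i \<omega> + a (m - K (Suc i) \<omega>)) \<in> measurable (G n) (count_space UNIV)"
      "(\<lambda>\<omega>. B i \<omega> + b (m - K (Suc i) \<omega>)) \<in> measurable (G n) (count_space UNIV)" by measurable
    moreover have "W (Suc i) \<in> measurable (G n) (count_space UNIV)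
        \<longleftrightarrow> (\<lambda>\<omega>. W i \<omega> + a (m - K (Suc i) \<omega>)) \<in> measurable (G n) (count_space UNIV)"
      using W_step[of "Suc i"] by (intro measurable_cong) simp
    moreover have "B (Suc i) \<in> measurable (G n) (count_space UNIV)
        \<longleftrightarrow> (\<lambda>\<omega>. B i \<omega> + b (m - K (Suc i) \<omega>)) \<in> measurable (G n) (count_space UNIV)"
      using B_step[of "Suc i"] by (intro measurable_cong) simp
    ultimately show ?case by simp
  qed
  then show "W i \<in> measurable (G n) (count_space UNIV)" "B i \<in> measurable (G n) (count_space UNIV)"
    by auto
qed

lemma W_draw_borel: "(\<lambda>\<omega>. real_of_int (W n \<omega>)) \<in> borel_measurable (G n)"
  using W_B_draw_measurable(1)[of n n] by measurable

lemma integrable_K: "1 \<le> n \<Longrightarrow> integrable M (\<lambda>\<omega>. real (K n \<omega>))"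
  using K_le K_measurable by (intro integrable_const_bound[where B = "real m"]) auto

lemma W_affine_step:
  assumes "affine_urn m a" "\<omega> \<in> space M"
  shows "real_of_int (W (Suc n) \<omega>)
           = real_of_int (W n \<omega>) + real_of_int (a m) + real_of_int (a (m - 1) - a m) * real (K (Suc n) \<omega>)"
  using W_step[of "Suc n" \<omega>] K_le[of "Suc n" \<omega>] affine_urn_rule[OF assms(1), of "K (Suc n) \<omega>"] assms(2)
  by simp

lemma integrable_W:
  assumes "affine_urn m a"
  shows "integrable M (\<lambda>\<omega>. real_of_int (W n \<omega>))"
proof (induction n)
  case 0
  have "integrable M (\<lambda>\<omega>. real_of_int (W 0 \<omega>)) \<longleftrightarrow> integrable M (\<lambda>_. real W0)"
    by (rule Bochner_Integration.integrable_cong) (simp_all add: W_0)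
  then show ?case by simp
next
  case (Suc n)
  have "integrable M (\<lambda>\<omega>. real_of_int (W n \<omega>) + real_of_int (a m)
                             + real_of_int (a (m - 1) - a m) * real (K (Suc n) \<omega>))"
    using Suc integrable_K[of "Suc n"] by simp
  moreover have "integrable M (\<lambda>\<omega>. real_of_int (W (Suc n) \<omega>))
      \<longleftrightarrow> integrable M (\<lambda>\<omega>. real_of_int (W n \<omega>) + real_of_int (a m)
                             + real_of_int (a (m - 1) - a m) * real (K (Suc n) \<omega>))"
    using W_affine_step[OF assms] by (intro Bochner_Integration.integrable_cong) auto
  ultimately show ?case by simp
qed

section \<open>Non-negativity of the urn contents\<close>

lemma AE_sample_prob_neq_0:
  "AE \<omega> in M. sample_prob model m (W n \<omega>) (B n \<omega>) (K (Suc n) \<omega>) \<noteq> 0"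
proof -
  interpret finite_measure_subalgebra M "G n" by standard (rule subalgebra_draw)
  note [measurable] = K_measurable[of "Suc n", simplified]
  \<comment> \<open>Each of the finitely many outcomes is treated as a fixed event; the random value
    \<open>K (Suc n) \<omega>\<close> is substituted afterwards.\<close>
  have "AE \<omega> in M. \<forall>k\<in>{..m}. K (Suc n) \<omega> = k \<longrightarrow> sample_prob model m (W n \<omega>) (B n \<omega>) k \<noteq> 0"
  proof (rule AE_finite_allI)
    fix k assume "k \<in> {..m}"
    then have "AE \<omega> in M. real_cond_exp M (G n) (indicator {\<omega> \<in> space M. K (Suc n) \<omega> = k}) \<omega>
                 = sample_prob model m (W n \<omega>) (B n \<omega>) k"
      using sampling[of "Suc n" k] by simp
    moreover have "AE \<omega> in M. \<omega> \<in> {\<omega> \<in> space M. K (Suc n) \<omega> = k} \<longrightarrow>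
        real_cond_exp M (G n) (indicator {\<omega> \<in> space M. K (Suc n) \<omega> = k}) \<omega> \<noteq> 0"
      by (rule AE_real_cond_exp_indicator_neq_0) measurable
    ultimately show "AE \<omega> in M. K (Suc n) \<omega> = k \<longrightarrow> sample_prob model m (W n \<omega>) (B n \<omega>) k \<noteq> 0"
      using AE_space by eventually_elim auto
  qed simp
  then show ?thesis using AE_space
  proof eventually_elim
    case (elim \<omega>)
    then show ?case using K_le[of "Suc n" \<omega>] by auto
  qed
qed

text \<open>Draws leading to a negative content have conditional probability zero, so each step of
  the induction discards only a null set.\<close>

lemma AE_W_B_nonneg:
  assumes "tenable_urn model m a b"
  shows "AE \<omega> in M. 0 \<le> W n \<omega> \<and> 0 \<le> B n \<omega>"
proof (induction n)
  case 0
  show ?case using AE_space by eventually_elim (simp add: W_0 B_0)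
next
  case (Suc n)
  show ?case using Suc AE_sample_prob_neq_0[of n] AE_space
  proof eventually_elim
    case (elim \<omega>)
    then show ?case
      using tenable_step_nonneg[OF assms K_le[of "Suc n" \<omega>], of "W n \<omega>" "B n \<omega>"]
        W_step[of "Suc n" \<omega>] B_step[of "Suc n" \<omega>] by simp
  qed
qed

section \<open>One-step conditional expectations\<close>

lemma total_balls_ge: "int m \<le> total_balls W0 B0 \<sigma> n"
proof -
  have "0 \<le> \<sigma> * int n" using balance_pos by simp
  then show ?thesis using initial_size by (simp add: total_balls_def)
qed

text \<open>The draw is a finite combination of the indicators of its values, whose conditional
  expectations are the sampling probabilities; what remains is the mean of the sampling law.\<close>

lemma cond_exp_K:
  assumes "tenable_urn model m a b"
  shows "AE \<omega> in M. real_cond_exp M (G n) (\<lambda>\<omega>. real (K (Suc n) \<omega>)) \<omega>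
           = real m * real_of_int (W n \<omega>) / real_of_int (total_balls W0 B0 \<sigma> n)"
proof -
  interpret finite_measure_subalgebra M "G n" by standard (rule subalgebra_draw)
  note [measurable] = K_measurable[of "Suc n", simplified]
  define I :: "nat \<Rightarrow> 'a \<Rightarrow> real"
    where "I k = indicator {\<omega> \<in> space M. K (Suc n) \<omega> = k}" for k
  have intI: "integrable M (I k)" for k
    unfolding I_def by (rule integrable_real_indicator) (auto simp: less_top[symmetric])
  have "AE \<omega> in M. real_cond_exp M (G n) (\<lambda>\<omega>. \<Sum>k\<le>m. real k * I k \<omega>) \<omega>
          = (\<Sum>k\<le>m. real_cond_exp M (G n) (\<lambda>\<omega>. real k * I k \<omega>) \<omega>)"
    using intI by (intro real_cond_exp_sum) auto
  moreover have "AE \<omega> in M. \<forall>k\<in>{..m}. real_cond_exp M (G n) (\<lambda>\<omega>. real k * I k \<omega>) \<omega>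
                    = real k * real_cond_exp M (G n) (I k) \<omega>"
    using intI by (intro AE_finite_allI real_cond_exp_cmult) auto
  moreover have "AE \<omega> in M. \<forall>k\<in>{..m}. real_cond_exp M (G n) (I k) \<omega>
                    = sample_prob model m (W n \<omega>) (B n \<omega>) k"
    unfolding I_def using sampling[of "Suc n"] by (intro AE_finite_allI) auto
  moreover have "AE \<omega> in M. real_cond_exp M (G n) (\<lambda>\<omega>. real (K (Suc n) \<omega>)) \<omega>
                    = real_cond_exp M (G n) (\<lambda>\<omega>. \<Sum>k\<le>m. real k * I k \<omega>) \<omega>"
  proof (rule real_cond_exp_cong)
    show "AE \<omega> in M. real (K (Suc n) \<omega>) = (\<Sum>k\<le>m. real k * I k \<omega>)"
      using AE_space
    proof eventually_elim
      case (elim \<omega>)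
      then have "(\<Sum>k\<le>m. real k * I k \<omega>) = (\<Sum>k\<le>m. if k = K (Suc n) \<omega> then real k else 0)"
        by (intro sum.cong) (auto simp: I_def)
      then show ?case using K_le[of "Suc n" \<omega>] elim by (simp add: sum.delta)
    qed
  qed (use intI in auto)
  ultimately show ?thesis using AE_W_B_nonneg[OF assms, of n] AE_space
  proof eventually_elim
    case (elim \<omega>)
    then have "real_cond_exp M (G n) (\<lambda>\<omega>. real (K (Suc n) \<omega>)) \<omega>
                 = (\<Sum>k\<le>m. real k * sample_prob model m (W n \<omega>) (B n \<omega>) k)"
      by simp
    also have "\<dots> = real m * real_of_int (W n \<omega>) / real_of_int (W n \<omega> + B n \<omega>)"
      using elim sample_size total_balls_ge[of n] total_balls_eq[of \<omega> n]
      by (intro sample_prob_mean) auto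
    \<comment> \<open>Balance makes the number of balls deterministic, which is what permits a
      deterministic scaling \<open>g\<close>.\<close>
    finally show ?case using total_balls_eq[of \<omega> n] elim by metis
  qed
qed

lemma cond_exp_W:
  assumes "tenable_urn model m a b" "affine_urn m a"
  defines "L \<equiv> real_of_int (a (m - 1) - a m)"
  shows "AE \<omega> in M. real_cond_exp M (G n) (\<lambda>\<omega>. real_of_int (W (Suc n) \<omega>)) \<omega>
           = (1 + real m * L / real_of_int (total_balls W0 B0 \<sigma> n)) * real_of_int (W n \<omega>)
               + real_of_int (a m)"
proof -
  interpret finite_measure_subalgebra M "G n" by standard (rule subalgebra_draw)
  let ?V = "\<lambda>\<omega>. real_of_int (W n \<omega>) + real_of_int (a m)"
  let ?D = "\<lambda>\<omega>. L * real (K (Suc n) \<omega>)"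
  have intW: "integrable M (\<lambda>\<omega>. real_of_int (W i \<omega>))" for i by (rule integrable_W[OF assms(2)])
  have intK: "integrable M (\<lambda>\<omega>. real (K (Suc n) \<omega>))" by (rule integrable_K) simp
  have "AE \<omega> in M. real_cond_exp M (G n) (\<lambda>\<omega>. real_of_int (W (Suc n) \<omega>)) \<omega>
          = real_cond_exp M (G n) (\<lambda>\<omega>. ?V \<omega> + ?D \<omega>) \<omega>"
  proof (rule real_cond_exp_cong)
    show "AE \<omega> in M. real_of_int (W (Suc n) \<omega>) = ?V \<omega> + ?D \<omega>"
      using AE_space by eventually_elim (simp add: W_affine_step[OF assms(2)] L_def)
  qed (use intW intK in auto)
  moreover have "AE \<omega> in M. real_cond_exp M (G n) (\<lambda>\<omega>. ?V \<omega> + ?D \<omega>) \<omega>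
                   = real_cond_exp M (G n) ?V \<omega> + real_cond_exp M (G n) ?D \<omega>"
    using intW intK by (intro real_cond_exp_add) auto
  moreover have "AE \<omega> in M. real_cond_exp M (G n) ?V \<omega> = ?V \<omega>"
    using intW W_draw_borel by (intro real_cond_exp_F_meas) auto
  moreover have "AE \<omega> in M. real_cond_exp M (G n) ?D \<omega>
                   = L * real_cond_exp M (G n) (\<lambda>\<omega>. real (K (Suc n) \<omega>)) \<omega>"
    using intK by (rule real_cond_exp_cmult)
  ultimately show ?thesis using cond_exp_K[OF assms(1), of n]
    by eventually_elim (simp add: algebra_simps)
qed

section \<open>Scaling and the martingale property\<close>

lemma scale_denominator_pos:
  assumes "0 < total_balls W0 B0 \<sigma> 0 + int m * (a (m - 1) - a m)"
  shows "0 < total_balls W0 B0 \<sigma> n + int m * (a (m - 1) - a m)"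
proof -
  have "0 \<le> \<sigma> * int n" using balance_pos by simp
  then show ?thesis using assms by (simp add: total_balls_def)
qed

lemma urn_scale_pos:
  assumes "0 < total_balls W0 B0 \<sigma> 0 + int m * (a (m - 1) - a m)"
  shows "0 < urn_scale m a (total_balls W0 B0 \<sigma>) n"
  unfolding urn_scale_def
proof (rule prod_pos, rule divide_pos_pos)
  fix j
  show "0 < real_of_int (total_balls W0 B0 \<sigma> j)"
    using total_balls_ge[of j] sample_size by simp
  show "0 < real_of_int (total_balls W0 B0 \<sigma> j + int m * (a (m - 1) - a m))"
    using scale_denominator_pos[OF assms, of j] by (simp only: of_int_0_less_iff)
qed

text \<open>The free constant \<open>c\<close> serves both cases: \<open>real W0\<close> centres the
  process, while \<open>0\<close> leaves \<open>g n\<close> times \<open>W n\<close> when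
  \<open>a m = 0\<close>.\<close>

lemma scaled_W_martingale:
  assumes tenable: "tenable_urn model m a b" and affine: "affine_urn m a"
    and pos: "0 < total_balls W0 B0 \<sigma> 0 + int m * (a (m - 1) - a m)"
  defines "g \<equiv> urn_scale m a (total_balls W0 B0 \<sigma>)"
  shows "discrete_martingale M G
           (\<lambda>n \<omega>. g n * real_of_int (W n \<omega>) - real_of_int (a m) * (\<Sum>j=1..n. g j) - c)"
proof -
  define d where "d n = real_of_int (a m) * (\<Sum>j=1..n. g j) + c" for n
  have intW: "integrable M (\<lambda>\<omega>. real_of_int (W n \<omega>))" for n by (rule integrable_W[OF affine])
  have meas: "(\<lambda>\<omega>. g n * real_of_int (W n \<omega>) - d n) \<in> borel_measurable (G n)" for n
    using W_draw_borel by auto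
  have step: "AE \<omega> in M. real_cond_exp M (G n) (\<lambda>\<omega>. g (Suc n) * real_of_int (W (Suc n) \<omega>) - d (Suc n)) \<omega>
                = g n * real_of_int (W n \<omega>) - d n" for n
  proof -
    interpret finite_measure_subalgebra M "G n" by standard (rule subalgebra_draw)
    let ?T = "real_of_int (total_balls W0 B0 \<sigma> n)" and ?L = "real_of_int (a (m - 1) - a m)"
    have T: "0 < ?T" using total_balls_ge[of n] sample_size by simp
    have TL: "0 < ?T + real m * ?L"
      using scale_denominator_pos[OF pos, of n]
      by (metis of_int_0_less_iff of_int_add of_int_mult of_int_of_nat_eq)
    have "g (Suc n) = g n * (?T / (?T + real m * ?L))"
      by (simp add: g_def urn_scale_def)
    \<comment> \<open>The new factor of the product is the reciprocal of the growth factor in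
      \<open>cond_exp_W\<close>.\<close>
    then have g: "g (Suc n) * (1 + real m * ?L / ?T) = g n"
      using T TL by (simp add: field_simps)
    \<comment> \<open>The compensator grows by exactly the drift \<open>a m\<close> after scaling by
      \<open>g (Suc n)\<close>.\<close>
    have d: "d (Suc n) = d n + g (Suc n) * real_of_int (a m)"
      by (simp add: d_def algebra_simps)
    have "AE \<omega> in M. real_cond_exp M (G n) (\<lambda>\<omega>. g (Suc n) * real_of_int (W (Suc n) \<omega>) - d (Suc n)) \<omega>
            = real_cond_exp M (G n) (\<lambda>\<omega>. g (Suc n) * real_of_int (W (Suc n) \<omega>)) \<omega>
                - real_cond_exp M (G n) (\<lambda>_. d (Suc n)) \<omega>"
      using intW by (intro real_cond_exp_diff) auto
    moreover have "AE \<omega> in M. real_cond_exp M (G n) (\<lambda>_. d (Suc n)) \<omega> = d (Suc n)"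
      by (intro real_cond_exp_F_meas) auto
    moreover have "AE \<omega> in M. real_cond_exp M (G n) (\<lambda>\<omega>. g (Suc n) * real_of_int (W (Suc n) \<omega>)) \<omega>
                     = g (Suc n) * real_cond_exp M (G n) (\<lambda>\<omega>. real_of_int (W (Suc n) \<omega>)) \<omega>"
      using intW by (rule real_cond_exp_cmult)
    ultimately show ?thesis using cond_exp_W[OF tenable affine, of n]
    proof eventually_elim
      case (elim \<omega>)
      have "g (Suc n) * ((1 + real m * ?L / ?T) * real_of_int (W n \<omega>) + real_of_int (a m)) - d (Suc n)
              = g (Suc n) * (1 + real m * ?L / ?T) * real_of_int (W n \<omega>) - d n"
        unfolding d by (simp add: distrib_left mult.assoc)
      then show ?case using elim g by simp
    qed
  qed
  have "AE \<omega> in M. real_cond_exp M (G (n - 1)) (\<lambda>\<omega>. g n * real_of_int (W n \<omega>) - d n) \<omega>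
                = g (n - 1) * real_of_int (W (n - 1) \<omega>) - d (n - 1)" if "1 \<le> n" for n
    using step[of "n - 1"] that by simp
  then have "discrete_martingale M G (\<lambda>n \<omega>. g n * real_of_int (W n \<omega>) - d n)"
    using filtration_draw subalgebra_draw meas intW by (simp add: discrete_martingale_def)
  then show ?thesis by (simp add: d_def diff_diff_eq)
qed

end

theorem proposition4:
  fixes M :: "'a measure"
    and model :: sampling_model
    and m :: nat
    and a b :: "nat \<Rightarrow> int"
    and \<sigma> :: int
    and W0 B0 :: nat
    and K :: "nat \<Rightarrow> 'a \<Rightarrow> nat"
    and W B :: "nat \<Rightarrow> 'a \<Rightarrow> int"
    and T :: "nat \<Rightarrow> int"
    and g :: "nat \<Rightarrow> real"
    and F :: "nat \<Rightarrow> 'a measure"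
    and X :: "nat \<Rightarrow> 'a \<Rightarrow> real"
  assumes "balanced_urn M model m a b \<sigma> W0 B0 K W B"
    and "tenable_urn model m a b"
    and "affine_urn m a"
    and "T = total_balls W0 B0 \<sigma>"
    and "T 0 + int m * (a (m - 1) - a m) > 0"
    and "g = urn_scale m a T"
    and "F = draw_filtration M K"
    and "X = (\<lambda>n \<omega>. g n * (real_of_int (W n \<omega>) - (\<integral>\<omega>'. real_of_int (W n \<omega>') \<partial>M)))"
  shows "(a m \<noteq> 0 \<longrightarrow>
           (\<forall>n. \<forall>\<omega>\<in>space M.
              X n \<omega> = g n * real_of_int (W n \<omega>) - real_of_int (a m) * (\<Sum>j=1..n. g j) - real W0) \<and>
           discrete_martingale M F X \<and>
           (\<forall>\<omega>\<in>space M. X 0 \<omega> = 0)) \<and>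
         (a m = 0 \<longrightarrow>
           discrete_martingale M F (\<lambda>n \<omega>. g n * real_of_int (W n \<omega>)) \<and>
           (\<forall>n. AE \<omega> in M. g n * real_of_int (W n \<omega>) \<ge> 0) \<and>
           (\<exists>W_inf \<in> borel_measurable M.
              AE \<omega> in M. (\<lambda>n. g n * real_of_int (W n \<omega>)) \<longlonglongrightarrow> W_inf \<omega>))"
proof -
  interpret balanced_urn M model m a b \<sigma> W0 B0 K W B by fact
  let ?Y = "\<lambda>n \<omega>. g n * real_of_int (W n \<omega>) - real_of_int (a m) * (\<Sum>j=1..n. g j) - real W0"
  note pos = assms(5)[unfolded assms(4)]
  have Y: "discrete_martingale M F ?Y"
    using scaled_W_martingale[OF assms(2,3) pos, of "real W0"] unfolding assms(4,6,7) .
  have g0: "g 0 = 1" by (simp add: assms(6) urn_scale_def)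
  have Y0: "?Y 0 \<omega> = 0" if "\<omega> \<in> space M" for \<omega> using W_0[OF that] g0 by simp
  \<comment> \<open>The martingale \<open>?Y\<close> starts at 0 and so has mean 0 at all times;
    this evaluates \<open>g n\<close> times the mean of \<open>W n\<close>.\<close>
  have "X = ?Y"
  proof (intro ext)
    fix n \<omega>
    have "expectation (?Y n) = 0"
      using discrete_martingale_expectation[OF Y, of n] Bochner_Integration.integral_cong[OF refl Y0]
      by simp
    then have "g n * expectation (\<lambda>\<omega>. real_of_int (W n \<omega>)) = real_of_int (a m) * (\<Sum>j=1..n. g j) + real W0"
      using integrable_W[OF assms(3), of n] by (simp add: prob_space)
    then show "X n \<omega> = ?Y n \<omega>" unfolding assms(8) by (simp add: right_diff_distrib)
  qed
  moreover have "discrete_martingale M F Z \<and> (\<forall>n. AE \<omega> in M. 0 \<le> Z n \<omega>) \<and>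
      (\<exists>Z_inf \<in> borel_measurable M. AE \<omega> in M. (\<lambda>n. Z n \<omega>) \<longlonglongrightarrow> Z_inf \<omega>)"
    if "a m = 0" and Z_def: "Z = (\<lambda>n \<omega>. g n * real_of_int (W n \<omega>))" for Z
  proof (intro conjI allI)
    show Z: "discrete_martingale M F Z"
      using scaled_W_martingale[OF assms(2,3) pos, of 0] that unfolding assms(4,6,7) by simp
    show nonneg: "AE \<omega> in M. 0 \<le> Z n \<omega>" for n
      using AE_W_B_nonneg[OF assms(2), of n]
    proof eventually_elim
      case (elim \<omega>)
      then show ?case using urn_scale_pos[OF pos, of n] unfolding Z_def assms(4,6) by simp
    qed
    have [measurable]: "Z n \<in> borel_measurable M" for n
      using Z by (auto simp: discrete_martingale_def)
    show "\<exists>Z_inf \<in> borel_measurable M. AE \<omega> in M. (\<lambda>n. Z n \<omega>) \<longlonglongrightarrow> Z_inf \<omega>"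
    \<comment> \<open>Where the sequence diverges, \<open>lim\<close> has an unspecified value; this
      concerns only a null set, and the function is still Borel measurable.\<close>
    proof (rule bexI[of _ "\<lambda>\<omega>. lim (\<lambda>n. Z n \<omega>)"])
      show "AE \<omega> in M. (\<lambda>n. Z n \<omega>) \<longlonglongrightarrow> lim (\<lambda>n. Z n \<omega>)"
        using nonneg_martingale_convergent[OF Z nonneg] by (simp add: convergent_LIMSEQ_iff)
    qed measurable
  qed
  ultimately show ?thesis using Y Y0 by simp
qed

end
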